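(* Let $q$ be a prime power, let $0<k<n$ and $0\le t\le k$ be integers. The graph $\Delta_t(n,k-1)$ is connected if and only if the graph $\widetilde{\Lambda}_t(n,k)$ is connected. In particular, $\Lambda_t(n,k)$ is the disjoint union of $\widetilde{\Lambda}_t(n,k)$ and the set $\mathcal{I}_t(n,k)$ of isolated vertices (which span no edges).
   Context: Let $V=\mathbb{F}_q^n$ with its standard basis. For $0\le m\le n$, an $[n,m]$-linear code is an $m$-dimensional subspace of $V$; a generator matrix of it is an $m\times n$ matrix whose rows form a basis of it. For an integer $t\ge 0$, $\mathcal{C}_t(n,m)$ denotes the set of $[n,m]$-codes such that any $t$ columns of a generator matrix are linearly independent (equivalently, the dual code has minimum Hamming distance at least $t+1$; this does not depend on the generator matrix). $\Delta_t(n,m)$ is the graph with vertex set $\mathcal{C}_t(n,m)$ in which $X,Y$ are adjacent iff $\dim(X\cap Y)=m-1$. $\Lambda_t(n,k)$ is the graph with vertex set $\mathcal{C}_t(n,k)$ in which $X,Y$ are adjacent iff $X\cap Y\in\mathcal{C}_t(n,k-1)$. A code $C\in\mathcal{C}_t(n,k)$ is isolated if it contains no subspace $D\in\mathcal{C}_t(n,k-1)$; $\mathcal{I}_t(n,k)$ is the set of isolated codes. $\widetilde{\Lambda}_t(n,k)$ is the subgraph of $\Lambda_t(n,k)$ induced on $\mathcal{C}_t(n,k)\setminus\mathcal{I}_t(n,k)$. The empty graph is considered connected. *)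

theory Defs
  imports "HOL-Analysis.Cartesian_Space" "Graph_Theory.Digraph_Component"
begin

text \<open>
  The field with \<open>q\<close> elements is a type \<open>'a :: {field, finite}\<close> with \<open>q = CARD('a)\<close>, and the
  ambient space is \<open>'a ^ 'n\<close> with \<open>n = CARD('n)\<close>. Subspaces and dimensions are those of the
  library's \<open>vec\<close> interpretation (vectors over an arbitrary field).
\<close>

definition linear_code :: "nat \<Rightarrow> ('a::{field,finite} ^ 'n::finite) set \<Rightarrow> bool" where
  "linear_code m C \<longleftrightarrow> vec.subspace C \<and> vec.dim C = m"

text \<open>
  An \<open>m \<times> n\<close> matrix is given by its rows \<open>G 0, \<dots>, G (m - 1)\<close>; the row index is a natural
  number because \<open>m\<close> varies and may be \<open>0\<close>. Values \<open>G i\<close> with \<open>i \<ge> m\<close> are irrelevant.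
\<close>

definition generator_matrix ::
  "nat \<Rightarrow> (nat \<Rightarrow> 'a::{field,finite} ^ 'n::finite) \<Rightarrow> ('a ^ 'n) set \<Rightarrow> bool" where
  "generator_matrix m G C \<longleftrightarrow>
     inj_on G {..<m} \<and> vec.independent (G ` {..<m}) \<and> vec.span (G ` {..<m}) = C"

text \<open>
  Columns are independent as a family indexed by positions: two equal columns at different
  positions are dependent.
\<close>

definition columns_independent ::
  "nat \<Rightarrow> (nat \<Rightarrow> 'a::{field,finite} ^ 'n::finite) \<Rightarrow> 'n set \<Rightarrow> bool" where
  "columns_independent m G T \<longleftrightarrow>
     (\<forall>c :: 'n \<Rightarrow> 'a. (\<forall>i<m. (\<Sum>j\<in>T. c j * G i $ j) = 0) \<longrightarrow> (\<forall>j\<in>T. c j = 0))"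

definition codes :: "nat \<Rightarrow> nat \<Rightarrow> ('a::{field,finite} ^ 'n::finite) set set" where
  "codes t m = {C. linear_code m C \<and>
     (\<exists>G. generator_matrix m G C \<and> (\<forall>T. card T = t \<longrightarrow> columns_independent m G T))}"

lemma columns_independent_iff:
  assumes "generator_matrix m G C"
  shows "columns_independent m G T \<longleftrightarrow>
    (\<forall>c. (\<forall>x\<in>C. (\<Sum>j\<in>T. c j * x $ j) = 0) \<longrightarrow> (\<forall>j\<in>T. c j = 0))"
proof -
  have "(\<forall>i<m. (\<Sum>j\<in>T. c j * G i $ j) = 0) \<longleftrightarrow> (\<forall>x\<in>C. (\<Sum>j\<in>T. c j * x $ j) = 0)" for c
  proof
    let ?S = "{x. (\<Sum>j\<in>T. c j * x $ j) = 0}"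
    have "vec.subspace ?S"
    proof (unfold vec.subspace_def, intro conjI ballI allI)
      show "0 \<in> ?S" by simp
      show "x + y \<in> ?S" if "x \<in> ?S" "y \<in> ?S" for x y
        using that by (simp add: distrib_left sum.distrib)
      show "a *s x \<in> ?S" if "x \<in> ?S" for a x
        using that by (simp add: mult.left_commute[of _ a] flip: sum_distrib_left)
    qed
    moreover assume "\<forall>i<m. (\<Sum>j\<in>T. c j * G i $ j) = 0"
    then have "G ` {..<m} \<subseteq> ?S" by auto
    ultimately have "vec.span (G ` {..<m}) \<subseteq> ?S" by (rule vec.span_minimal[rotated])
    then show "\<forall>x\<in>C. (\<Sum>j\<in>T. c j * x $ j) = 0"
      using assms by (auto simp: generator_matrix_def)
  next
    assume "\<forall>x\<in>C. (\<Sum>j\<in>T. c j * x $ j) = 0"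
    then show "\<forall>i<m. (\<Sum>j\<in>T. c j * G i $ j) = 0"
      using assms vec.span_superset[of "G ` {..<m}"] by (auto simp: generator_matrix_def)
  qed
  then show ?thesis by (simp only: columns_independent_def)
qed

text \<open>Membership in \<open>codes t m\<close> does not depend on the generator matrix.\<close>

lemma codes_iff_generator_matrix:
  assumes "generator_matrix m G C"
  shows "C \<in> codes t m \<longleftrightarrow> (\<forall>T. card T = t \<longrightarrow> columns_independent m G T)"
proof -
  have "linear_code m C"
    using assms
    by (auto simp: linear_code_def generator_matrix_def card_image vec.dim_eq_card_independent)
  moreover have "(\<forall>T. card T = t \<longrightarrow> columns_independent m G T)"
    if "generator_matrix m G' C" "\<forall>T. card T = t \<longrightarrow> columns_independent m G' T" for G'
    using that(2) unfolding columns_independent_iff[OF that(1)] columns_independent_iff[OF assms] .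
  ultimately show ?thesis
    using assms unfolding codes_def mem_Collect_eq by metis
qed

text \<open>
  Simple graphs are symmetric loop-free \<open>pair_pre_digraph\<close>s. The condition on \<open>vec.dim\<close> in
  \<open>Delta\<close> is written additively so that there is no loop when \<open>m = 0\<close>.
\<close>

definition Delta :: "nat \<Rightarrow> nat \<Rightarrow> ('a::{field,finite} ^ 'n::finite) set pair_pre_digraph" where
  "Delta t m = \<lparr>pverts = codes t m,
     parcs = {(X, Y). X \<in> codes t m \<and> Y \<in> codes t m \<and> vec.dim (X \<inter> Y) + 1 = m}\<rparr>"

definition Lambda :: "nat \<Rightarrow> nat \<Rightarrow> ('a::{field,finite} ^ 'n::finite) set pair_pre_digraph" where
  "Lambda t k = \<lparr>pverts = codes t k,
     parcs = {(X, Y). X \<in> codes t k \<and> Y \<in> codes t k \<and> X \<inter> Y \<in> codes t (k - 1)}\<rparr>"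

definition isolated_codes :: "nat \<Rightarrow> nat \<Rightarrow> ('a::{field,finite} ^ 'n::finite) set set" where
  "isolated_codes t k = {C \<in> codes t k. \<not> (\<exists>D \<in> codes t (k - 1). D \<subseteq> C)}"

definition Lambda_tilde ::
  "nat \<Rightarrow> nat \<Rightarrow>
    (('a::{field,finite} ^ 'n::finite) set, ('a ^ 'n) set \<times> ('a ^ 'n) set) pre_digraph" where
  "Lambda_tilde t k = with_proj (Lambda t k) \<restriction> (codes t k - isolated_codes t k)"

text \<open>The library's \<^const>\<open>Digraph_Component.connected\<close> excludes the empty graph.\<close>

definition connected_graph :: "('v, 'e) pre_digraph \<Rightarrow> bool" where
  "connected_graph G \<longleftrightarrow> verts G = {} \<or> Digraph_Component.connected G"

lemma dim_codes: "C \<in> codes t m \<Longrightarrow> vec.dim C = m"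
  by (simp add: codes_def linear_code_def)

lemma pair_graph_Delta: "pair_graph (Delta t m :: ('a::{field,finite} ^ 'n::finite) set pair_pre_digraph)"
proof unfold_locales
  fix e :: "('a ^ 'n) set \<times> ('a ^ 'n) set"
  assume "e \<in> parcs (Delta t m)"
  then obtain X Y where e: "e = (X, Y)" "X \<in> codes t m" "Y \<in> codes t m"
    "vec.dim (X \<inter> Y) + 1 = m"
    by (cases e) (simp add: Delta_def)
  then show "fst e \<in> pverts (Delta t m)" "snd e \<in> pverts (Delta t m)"
    by (simp_all add: Delta_def)
  show "fst e \<noteq> snd e"
  proof
    assume "fst e = snd e"
    with e have "vec.dim X + 1 = m" by simp
    with dim_codes[OF e(2)] show False by simp
  qed
next
  show "symmetric (with_proj (Delta t m :: ('a ^ 'n) set pair_pre_digraph))"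
    unfolding symmetric_def with_proj_simps by (rule symI) (simp add: Delta_def Int_commute)
  show "finite (pverts (Delta t m :: ('a ^ 'n) set pair_pre_digraph))"
    by (rule finite)
  show "finite (parcs (Delta t m :: ('a ^ 'n) set pair_pre_digraph))"
    by (rule finite)
qed

lemma pair_graph_Lambda:
  assumes "0 < k"
  shows "pair_graph (Lambda t k :: ('a::{field,finite} ^ 'n::finite) set pair_pre_digraph)"
proof unfold_locales
  fix e :: "('a ^ 'n) set \<times> ('a ^ 'n) set"
  assume "e \<in> parcs (Lambda t k)"
  then obtain X Y where e: "e = (X, Y)" "X \<in> codes t k" "Y \<in> codes t k"
    "X \<inter> Y \<in> codes t (k - 1)"
    by (cases e) (simp add: Lambda_def)
  then show "fst e \<in> pverts (Lambda t k)" "snd e \<in> pverts (Lambda t k)"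
    by (simp_all add: Lambda_def)
  show "fst e \<noteq> snd e"
  proof
    assume "fst e = snd e"
    with e have "X \<in> codes t (k - 1)" by simp
    from dim_codes[OF this] dim_codes[OF e(2)] assms show False by simp
  qed
next
  show "symmetric (with_proj (Lambda t k :: ('a ^ 'n) set pair_pre_digraph))"
    unfolding symmetric_def with_proj_simps by (rule symI) (simp add: Lambda_def Int_commute)
  show "finite (pverts (Lambda t k :: ('a ^ 'n) set pair_pre_digraph))"
    by (rule finite)
  show "finite (parcs (Lambda t k :: ('a ^ 'n) set pair_pre_digraph))"
    by (rule finite)
qed

end

theory Submission
  imports Defs
begin

text \<open>
  Consider the inclusion relation between \<open>(k - 1)\<close>-codes and \<open>k\<close>-codes. The column condition
  passes to larger subspaces. Hence two adjacent vertices of \<open>Delta t (k - 1)\<close> have a common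
  neighbour under inclusion (their sum), two adjacent vertices of \<open>Lambda t k\<close> have one as well
  (their intersection), and conversely two vertices with a common neighbour are equal or adjacent.
  Both graphs are thus the two halves of one bipartite graph, so walks in either translate into
  walks in the other.
\<close>

lemma generator_matrix_exists:
  fixes C :: "('a::{field,finite} ^ 'n::finite) set"
  assumes "linear_code m C"
  shows "\<exists>G. generator_matrix m G C"
proof -
  have sub: "vec.subspace C" and dim: "vec.dim C = m"
    using assms by (auto simp: linear_code_def)
  obtain B where B: "B \<subseteq> C" "vec.independent B" "vec.span B = C" "card B = m"
    using vec.basis_subspace_exists[OF sub] dim by metis
  then obtain G where "bij_betw G {..<m} B"
    using finite_same_card_bij[of "{..<m}" B] by auto
  with B show ?thesis
    unfolding generator_matrix_def bij_betw_def by metis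
qed

text \<open>A linear relation among the columns of a generator matrix is the same as one satisfied
  by all codewords, and every subspace has a generator matrix. So the matrix can be eliminated from
  \<open>codes\<close>.\<close>

lemma codes_iff:
  fixes C :: "('a::{field,finite} ^ 'n::finite) set"
  shows "C \<in> codes t m \<longleftrightarrow> vec.subspace C \<and> vec.dim C = m \<and>
    (\<forall>T. card T = t \<longrightarrow>
      (\<forall>c. (\<forall>x\<in>C. (\<Sum>j\<in>T. c j * x $ j) = 0) \<longrightarrow> (\<forall>j\<in>T. c j = 0)))"
proof (cases "linear_code m C")
  case True
  then obtain G where G: "generator_matrix m G C"
    using generator_matrix_exists by blast
  from True show ?thesis
    unfolding codes_iff_generator_matrix[OF G] columns_independent_iff[OF G] linear_code_def
    by simp
next
  case False
  then show ?thesis by (auto simp: codes_def linear_code_def)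
qed

lemma subspace_codes: "C \<in> codes t m \<Longrightarrow> vec.subspace C"
  by (simp add: codes_iff)

text \<open>Coefficients that annihilate \<open>C\<close> also annihilate \<open>D\<close>, so
  enlarging a code creates no new column relations.\<close>

lemma codes_superspace:
  assumes "D \<in> codes t m" "D \<subseteq> C" "vec.subspace C"
  shows "C \<in> codes t (vec.dim C)"
proof -
  have "\<forall>j\<in>T. c j = 0" if "card T = t" "\<forall>x\<in>C. (\<Sum>j\<in>T. c j * x $ j) = 0" for T c
  proof -
    have "\<forall>x\<in>D. (\<Sum>j\<in>T. c j * x $ j) = 0"
      using that(2) assms(2) by blast
    with assms(1) that(1) show ?thesis unfolding codes_iff by blast
  qed
  with assms(3) show ?thesis unfolding codes_iff by blast
qed

lemma dim_Int_codes_less: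
  assumes "C \<in> codes t m" "D \<in> codes t m" "C \<noteq> D"
  shows "vec.dim (C \<inter> D) < m"
proof (rule ccontr)
  assume "\<not> vec.dim (C \<inter> D) < m"
  then have "C \<inter> D = C" "C \<inter> D = D"
    using assms vec.subspace_dim_equal[of "C \<inter> D"]
    by (simp_all add: subspace_codes vec.subspace_inter dim_codes)
  with assms(3) show False by simp
qed

text \<open>Adjoin any vector outside \<open>D\<close>. This ensures that no vertex of
  \<open>Delta t (k - 1)\<close> lacks a neighbour under inclusion.\<close>

lemma codes_extend:
  fixes D :: "('a::{field,finite} ^ 'n::finite) set"
  assumes D: "D \<in> codes t m" and "m < CARD('n)"
  shows "\<exists>X \<in> codes t (m + 1). D \<subseteq> X"
proof -
  have "vec.span D \<noteq> UNIV"
    using assms dim_codes[OF D] by (metis less_irrefl vec.dim_span vec_dim_card)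
  then obtain v where v: "v \<notin> vec.span D" by blast
  let ?X = "vec.span (insert v D)"
  have "vec.dim ?X = m + 1"
    using v dim_codes[OF D] by (simp add: vec.dim_insert)
  moreover have "D \<subseteq> ?X"
    using vec.span_superset by blast
  ultimately show ?thesis
    using codes_superspace[OF D \<open>D \<subseteq> ?X\<close>] by auto
qed

text \<open>Distinct codes meet in dimension at most \<open>k - 1\<close>, which a common subcode
  \<open>D\<close> already attains.\<close>

lemma codes_Int_eq:
  assumes "X \<in> codes t k" "Y \<in> codes t k" "X \<noteq> Y"
    and "D \<in> codes t (k - 1)" "D \<subseteq> X" "D \<subseteq> Y"
  shows "X \<inter> Y = D"
proof -
  have "vec.dim (X \<inter> Y) \<le> vec.dim D"
    using dim_Int_codes_less[OF assms(1-3)] dim_codes[OF assms(4)] by simp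
  then show ?thesis
    using assms vec.subspace_dim_equal[of D "X \<inter> Y"]
    by (auto simp: subspace_codes vec.subspace_inter)
qed

text \<open>The sum \<open>D + E\<close> lies in \<open>X\<close>, so the dimension formula bounds
  the intersection below by \<open>m - 1\<close>; distinctness bounds it above.\<close>

lemma codes_common_superspace_adjacent:
  assumes D: "D \<in> codes t m" and E: "E \<in> codes t m" and "D \<noteq> E"
    and X: "X \<in> codes t (m + 1)" "D \<subseteq> X" "E \<subseteq> X"
  shows "vec.dim (D \<inter> E) + 1 = m"
proof -
  let ?S = "{x + y |x y. x \<in> D \<and> y \<in> E}"
  have "?S \<subseteq> X"
    using X subspace_codes[OF X(1)] by (auto intro: vec.subspace_add)
  then have "vec.dim ?S \<le> m + 1"
    using vec.dim_subset[of ?S X] dim_codes[OF X(1)] by simp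
  moreover have "vec.dim ?S + vec.dim (D \<inter> E) = m + m"
    using vec.dim_sums_Int[OF subspace_codes[OF D] subspace_codes[OF E]]
      dim_codes[OF D] dim_codes[OF E] by simp
  moreover have "vec.dim (D \<inter> E) < m"
    using dim_Int_codes_less[OF D E \<open>D \<noteq> E\<close>] .
  ultimately show ?thesis by linarith
qed

text \<open>The witness is \<open>D + E\<close>: its dimension is \<open>m + m - (m - 1)\<close>,
  and it inherits the column condition from \<open>D\<close>.\<close>

lemma codes_adjacent_common_superspace:
  assumes D: "D \<in> codes t m" and E: "E \<in> codes t m" and "vec.dim (D \<inter> E) + 1 = m"
  shows "\<exists>X \<in> codes t (m + 1). D \<subseteq> X \<and> E \<subseteq> X"
proof -
  let ?S = "{x + y |x y. x \<in> D \<and> y \<in> E}"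
  have sub: "vec.subspace D" "vec.subspace E"
    using D E by (auto simp: subspace_codes)
  have "D \<subseteq> ?S" "E \<subseteq> ?S"
    using sub[THEN vec.subspace_0] by force+
  moreover have "vec.dim ?S = m + 1"
    using vec.dim_sums_Int[OF sub] dim_codes[OF D] dim_codes[OF E] assms(3) by simp
  ultimately show ?thesis
    using codes_superspace[OF D \<open>D \<subseteq> ?S\<close> vec.subspace_sums[OF sub]] by auto
qed

text \<open>\<open>Q\<close> is the incidence relation of a bipartite graph, with \<open>R\<close>
  and \<open>S\<close> on its two sides. Each \<open>R\<close>-step yields a common neighbour, and
  successive neighbours share an \<open>R\<close>-vertex, so \<open>same\<close> links them.\<close>

lemma rtrancl_transfer:
  assumes walk: "(x, y) \<in> R\<^sup>*" and "Q x u" "Q y v"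
    and step: "\<And>x y. (x, y) \<in> R \<Longrightarrow> \<exists>w. Q x w \<and> Q y w"
    and same: "\<And>x u v. Q x u \<Longrightarrow> Q x v \<Longrightarrow> (u, v) \<in> S\<^sup>*"
  shows "(u, v) \<in> S\<^sup>*"
  using walk \<open>Q y v\<close>
proof (induction arbitrary: v rule: rtrancl_induct)
  case base
  show ?case by (rule same[OF \<open>Q x u\<close> base])
next
  case (step y z)
  obtain w where w: "Q y w" "Q z w" using assms(4)[OF step(2)] by blast
  \<comment> \<open>The induction hypothesis leads from \<open>u\<close> to \<open>w\<close>; then
    \<open>w\<close> and \<open>v\<close> are both neighbours of \<open>z\<close>.\<close>
  show ?case using step(3)[OF w(1)] same[OF w(2) step(4)] by (rule rtrancl_trans)
qed

text \<open>Symmetry makes reachability in the symmetric closure plain reachability; the empty graph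
  satisfies the right-hand side vacuously.\<close>

lemma connected_graph_iff:
  assumes "wf_digraph G" "symmetric G"
  shows "connected_graph G \<longleftrightarrow> (\<forall>u \<in> verts G. \<forall>v \<in> verts G. (u, v) \<in> (arcs_ends G)\<^sup>*)"
proof -
  interpret wf_digraph G by fact
  show ?thesis
    unfolding connected_graph_def connected_def strongly_connected_def
    by (auto simp: reachable_mk_symmetric_eq[OF assms(2)] reachable_conv')
qed

text \<open>Removing isolated codes loses no arcs, since \<open>X \<inter> Y\<close> is itself a
  subcode witnessing that both ends are not isolated.\<close>

lemma arcs_ends_Lambda_tilde:
  "arcs_ends (Lambda_tilde t k) =
    {(X, Y). X \<in> codes t k \<and> Y \<in> codes t k \<and> X \<inter> Y \<in> codes t (k - 1)}"
  by (auto simp: Lambda_tilde_def Lambda_def isolated_codes_def arcs_ends_def arc_to_ends_def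
      image_iff)

lemma verts_Lambda_tilde:
  "verts (Lambda_tilde t k) = {X \<in> codes t k. \<exists>D \<in> codes t (k - 1). D \<subseteq> X}"
  by (auto simp: Lambda_tilde_def isolated_codes_def)

lemma connected_Lambda_tilde_iff:
  "connected_graph (Lambda_tilde t k ::
      (('a::{field,finite} ^ 'n::finite) set, ('a ^ 'n) set \<times> ('a ^ 'n) set) pre_digraph) \<longleftrightarrow>
    (\<forall>X \<in> verts (Lambda_tilde t k). \<forall>Y \<in> verts (Lambda_tilde t k).
      (X, Y :: ('a ^ 'n) set) \<in> (arcs_ends (Lambda_tilde t k))\<^sup>*)"
proof (rule connected_graph_iff)
  show "wf_digraph (Lambda_tilde t k ::
      (('a ^ 'n) set, ('a ^ 'n) set \<times> ('a ^ 'n) set) pre_digraph)"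
    by unfold_locales (auto simp: Lambda_tilde_def)
  show "symmetric (Lambda_tilde t k ::
      (('a ^ 'n) set, ('a ^ 'n) set \<times> ('a ^ 'n) set) pre_digraph)"
    unfolding symmetric_def arcs_ends_Lambda_tilde by (auto intro!: symI simp: Int_commute)
qed

lemma connected_Delta_iff:
  "connected_graph (with_proj (Delta t m :: ('a::{field,finite} ^ 'n::finite) set pair_pre_digraph)) \<longleftrightarrow>
    (\<forall>X \<in> codes t m. \<forall>Y \<in> codes t m. (X, Y :: ('a ^ 'n) set) \<in> (parcs (Delta t m))\<^sup>*)"
proof -
  interpret pair_graph "Delta t m :: ('a ^ 'n) set pair_pre_digraph" by (rule pair_graph_Delta)
  show ?thesis
    using connected_graph_iff[OF wf_digraph sym_arcs] by (simp add: Delta_def)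
qed

lemma connected_Delta_iff_connected_Lambda_tilde:
  assumes "0 < k" "k \<le> CARD('n::finite)"
  shows "connected_graph (with_proj (Delta t (k - 1) :: ('a::{field,finite} ^ 'n) set pair_pre_digraph))
    \<longleftrightarrow> connected_graph (Lambda_tilde t k :: (('a ^ 'n) set, ('a ^ 'n) set \<times> ('a ^ 'n) set) pre_digraph)"
proof -
  define Q :: "('a ^ 'n) set \<Rightarrow> ('a ^ 'n) set \<Rightarrow> bool"
    where "Q D X \<longleftrightarrow> D \<in> codes t (k - 1) \<and> X \<in> codes t k \<and> D \<subseteq> X" for D X
  let ?R = "parcs (Delta t (k - 1)) :: (('a ^ 'n) set \<times> ('a ^ 'n) set) set"
  let ?S = "arcs_ends (Lambda_tilde t k) :: (('a ^ 'n) set \<times> ('a ^ 'n) set) set"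
  have k: "k - 1 + 1 = k" using assms by simp
  have R_step: "\<exists>X. Q D X \<and> Q E X" if "(D, E) \<in> ?R" for D E
    using that codes_adjacent_common_superspace[of D t "k - 1" E] k
    by (auto simp: Delta_def Q_def)
  have S_step: "\<exists>D. Q D X \<and> Q D Y" if "(X, Y) \<in> ?S" for X Y
    using that by (auto simp: arcs_ends_Lambda_tilde Q_def)
  have R_same: "(D, E) \<in> ?R\<^sup>*" if "Q D X" "Q E X" for D E X
    using that codes_common_superspace_adjacent[of D t "k - 1" E X] k
    by (cases "D = E") (auto simp: Delta_def Q_def)
  have S_same: "(X, Y) \<in> ?S\<^sup>*" if "Q D X" "Q D Y" for D X Y
    using that codes_Int_eq[of X t k Y D]
    by (cases "X = Y") (auto simp: arcs_ends_Lambda_tilde Q_def)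
  have R_verts: "\<exists>X. Q D X" if "D \<in> codes t (k - 1)" for D
    using codes_extend[OF that] assms k that by (auto simp: Q_def)
  \<comment> \<open>On this side codes without a neighbour may exist; they are exactly the isolated
    ones.\<close>
  have S_verts: "X \<in> verts (Lambda_tilde t k) \<longleftrightarrow> (\<exists>D. Q D X)" for X
    by (auto simp: verts_Lambda_tilde Q_def)
  show ?thesis
    unfolding connected_Delta_iff connected_Lambda_tilde_iff
  proof (intro iffI ballI)
    fix X Y :: "('a ^ 'n) set"
    assume R: "\<forall>D \<in> codes t (k - 1). \<forall>E \<in> codes t (k - 1). (D, E) \<in> ?R\<^sup>*"
      and "X \<in> verts (Lambda_tilde t k)" "Y \<in> verts (Lambda_tilde t k)"
    then obtain D E where DE: "Q D X" "Q E Y" by (auto simp: S_verts)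
    with R have "(D, E) \<in> ?R\<^sup>*" by (simp add: Q_def)
    from this DE R_step S_same show "(X, Y) \<in> ?S\<^sup>*" by (rule rtrancl_transfer)
  next
    fix D E :: "('a ^ 'n) set"
    assume S: "\<forall>X \<in> verts (Lambda_tilde t k). \<forall>Y \<in> verts (Lambda_tilde t k). (X, Y) \<in> ?S\<^sup>*"
      and "D \<in> codes t (k - 1)" "E \<in> codes t (k - 1)"
    then obtain X Y where XY: "Q D X" "Q E Y" using R_verts by meson
    with S have "(X, Y) \<in> ?S\<^sup>*" using S_verts by blast
    \<comment> \<open>The two sides exchange roles, so the incidence relation is the converse of
      \<open>Q\<close>.\<close>
    from this XY S_step R_same show "(D, E) \<in> ?R\<^sup>*"
      by (rule rtrancl_transfer[of X Y ?S "\<lambda>X D. Q D X"])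
  qed
qed

theorem theorem1p4:
  fixes k t :: nat
  assumes "0 < k" and "k < CARD('n::finite)" and "t \<le> k"
  shows "(connected_graph (with_proj (Delta t (k - 1) :: ('a::{field,finite} ^ 'n) set pair_pre_digraph))
            \<longleftrightarrow> connected_graph (Lambda_tilde t k :: (('a ^ 'n) set, ('a ^ 'n) set \<times> ('a ^ 'n) set) pre_digraph))
       \<and> with_proj (Lambda t k :: ('a ^ 'n) set pair_pre_digraph)
            = union (Lambda_tilde t k) (with_proj (Lambda t k) \<restriction> isolated_codes t k)
       \<and> verts (Lambda_tilde t k) \<inter> (isolated_codes t k :: ('a ^ 'n) set set) = {}
       \<and> arcs (with_proj (Lambda t k :: ('a ^ 'n) set pair_pre_digraph) \<restriction> isolated_codes t k) = {}"
proof (intro conjI)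
  show "connected_graph (with_proj (Delta t (k - 1) :: ('a ^ 'n) set pair_pre_digraph))
      \<longleftrightarrow> connected_graph (Lambda_tilde t k :: (('a ^ 'n) set, ('a ^ 'n) set \<times> ('a ^ 'n) set) pre_digraph)"
    using assms by (intro connected_Delta_iff_connected_Lambda_tilde) auto
  show "with_proj (Lambda t k :: ('a ^ 'n) set pair_pre_digraph)
      = union (Lambda_tilde t k) (with_proj (Lambda t k) \<restriction> isolated_codes t k)"
    by (auto simp: Lambda_tilde_def Lambda_def isolated_codes_def union_def induce_subgraph_def
        with_proj_def)
  show "verts (Lambda_tilde t k) \<inter> (isolated_codes t k :: ('a ^ 'n) set set) = {}"
    by (auto simp: Lambda_tilde_def)
  \<comment> \<open>The intersection of the ends of such an arc would be a forbidden
    subcode.\<close>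
  show "arcs (with_proj (Lambda t k :: ('a ^ 'n) set pair_pre_digraph) \<restriction> isolated_codes t k) = {}"
    by (auto simp: Lambda_def isolated_codes_def)
qed

end
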